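(* Let $(\mathfrak{J},\alpha,\omega)$ be a cosymplectic JJ-algebra with product $\cdot$, and let $(\varphi,a)$ be an admissible pair of $(\mathfrak{J},\cdot)$. Let $\tilde{\mathfrak{J}}=\langle d\rangle\oplus\mathfrak{J}\oplus\langle e\rangle$ be equipped with the product $$x\bullet y=x\cdot y+\omega_\varphi(x,y)e,\qquad d\bullet x=\varphi(x)+\tfrac12\omega(a,x)e,\qquad d\bullet d=a\in\mathfrak{J},$$ for any $x,y\in\mathfrak{J}$. Then $$\tilde\alpha=\alpha+t\,d^*\quad\text{and}\quad\tilde\omega=\omega+d^*\wedge e^*,\qquad t\in\mathbb{K},$$ is a cosymplectic structure on $\tilde{\mathfrak{J}}$ if $\alpha\circ\varphi=0$ and $\omega(\varphi(x),a)=0$ for any $x\in\mathfrak{J}$.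
   Context: All algebras are finite-dimensional over a field $\mathbb{K}$ of characteristic different from $2$ and $3$. A JJ-algebra (Jacobi-Jordan algebra) is a vector space $\mathfrak{J}$ with a commutative bilinear product $\cdot$ satisfying $x\cdot(y\cdot z)+y\cdot(z\cdot x)+z\cdot(x\cdot y)=0$ for all $x,y,z$. An anti-derivation of $(\mathfrak{J},\cdot)$ is a linear map $\mathrm D:\mathfrak{J}\to\mathfrak{J}$ with $\mathrm{D}(x\cdot y)=-\mathrm{D}(x)\cdot y-x\cdot\mathrm{D}(y)$ for all $x,y$. An admissible pair of $(\mathfrak{J},\cdot)$ is a pair $(\varphi,a)$ with $\varphi$ an anti-derivation of $\mathfrak{J}$ and $a\in\ker(\varphi)$ such that $\varphi^2=-\frac12\mathrm{L}_a$, where $\mathrm{L}_a(x)=a\cdot x$. Notation: $\omega_\varphi(x,y)=\omega(\varphi(x),y)+\omega(\varphi(y),x)$ for $x,y\in\mathfrak{J}$. The product $\bullet$ is commutative and all products with $e$ are zero. The linear forms $d^*,e^*$ on $\tilde{\mathfrak{J}}$ are dual to $d,e$ and vanish on $\mathfrak{J}$; $\alpha$ and $\omega$ are extended by zero on $d,e$; $(d^*\wedge e^* )(x,y)=d^*(x)e^*(y)-d^*(y)e^*(x)$. A cosymplectic structure on a JJ-algebra $(\mathfrak{J},\cdot)$ of dimension $2n+1$ is a pair $(\alpha,\omega)$ with $\alpha$ a $1$-form (linear form) and $\omega$ a skew-symmetric bilinear form such that $\alpha\wedge\omega^n\neq0$ (where $\omega^n$ is the $n$-fold wedge power of $\omega$),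 $\alpha(x\cdot y)=0$, and $\omega(x\cdot y,z)+\omega(z\cdot x,y)+\omega(y\cdot z,x)=0$ for all $x,y,z\in\mathfrak{J}$; $(\mathfrak{J},\alpha,\omega)$ is then called a cosymplectic JJ-algebra.
   Formalization: Two conditions are added, both necessary for the conclusion: α(a)=0 (otherwise α̃(d•d)=α(a)≠0), and the characteristic of K does not divide n+1 where dim J=2n+1 (otherwise α̃∧ω̃^(n+1)=0; automatic in characteristic 0). *)

theory Defs
  imports
    Complex_Main
    "HOL-Combinatorics.Permutations"
    "HOL-Library.Product_Plus"
begin

section \<open>Multilinear forms and the wedge product\<close>

text \<open>
  A \<open>k\<close>-form on \<open>'v\<close> is represented by a function of type \<open>(nat \<Rightarrow> 'v) \<Rightarrow> 'k\<close> that reads only the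
  arguments \<open>v 0, \<dots>, v (k - 1)\<close>. The wedge product of a \<open>k\<close>-form and an \<open>l\<close>-form is the sum over
  the \<open>(k, l)\<close>-shuffles. It has no factorials in denominators, so it makes sense over every field,
  and it agrees with \<open>(f \<and> g)(x, y) = f x * g y - f y * g x\<close> for linear forms \<open>f\<close>, \<open>g\<close>
  (lemma \<open>wedge_1_1\<close>).
\<close>

definition shuffle_perms :: "nat \<Rightarrow> nat \<Rightarrow> (nat \<Rightarrow> nat) set" where
  "shuffle_perms k l = {\<sigma>. \<sigma> permutes {..<k + l} \<and>
     strict_mono_on {..<k} \<sigma> \<and> strict_mono_on {k..<k + l} \<sigma>}"

definition wedge ::
  "nat \<Rightarrow> nat \<Rightarrow> ((nat \<Rightarrow> 'v) \<Rightarrow> 'k::field) \<Rightarrow> ((nat \<Rightarrow> 'v) \<Rightarrow> 'k) \<Rightarrow> (nat \<Rightarrow> 'v) \<Rightarrow> 'k" where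
  "wedge k l f g v =
     (\<Sum>\<sigma>\<in>shuffle_perms k l. of_int (sign \<sigma>) * f (\<lambda>i. v (\<sigma> i)) * g (\<lambda>i. v (\<sigma> (k + i))))"

definition form1 :: "('v \<Rightarrow> 'k::field) \<Rightarrow> (nat \<Rightarrow> 'v) \<Rightarrow> 'k" where
  "form1 \<alpha> v = \<alpha> (v 0)"

definition form2 :: "('v \<Rightarrow> 'v \<Rightarrow> 'k::field) \<Rightarrow> (nat \<Rightarrow> 'v) \<Rightarrow> 'k" where
  "form2 \<omega> v = \<omega> (v 0) (v 1)"

text \<open>The \<open>m\<close>-fold wedge power of a 2-form, a \<open>2 * m\<close>-form.\<close>

primrec wedge_power :: "('v \<Rightarrow> 'v \<Rightarrow> 'k::field) \<Rightarrow> nat \<Rightarrow> (nat \<Rightarrow> 'v) \<Rightarrow> 'k" where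
  "wedge_power \<omega> 0 = (\<lambda>_. 1)"
| "wedge_power \<omega> (Suc m) = wedge 2 (2 * m) (form2 \<omega>) (wedge_power \<omega> m)"

lemma wedge_1_1: "wedge 1 1 (form1 f) (form1 g) v = f (v 0) * g (v 1) - f (v 1) * g (v 0)"
proof -
  have S: "{..<1 + 1} = {0, 1::nat}"
    by auto
  have "shuffle_perms 1 1 = {\<sigma>. \<sigma> permutes {0, 1::nat}}"
    unfolding shuffle_perms_def S by (auto simp: strict_mono_on_def)
  also have "\<dots> = {id, transpose 0 1}"
    by (auto simp: permutes_doubleton_iff)
  finally have 1: "shuffle_perms 1 1 = {id, transpose 0 (1::nat)}" .
  have "transpose 0 (1::nat) \<noteq> id"
    by (metis id_apply transpose_apply_first zero_neq_one)
  then show ?thesis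
    unfolding wedge_def 1 by (simp add: form1_def sign_swap_id)
qed


section \<open>Jacobi-Jordan algebras\<close>

definition bilinear_map ::
  "('k::field \<Rightarrow> 'u::ab_group_add \<Rightarrow> 'u) \<Rightarrow> ('k \<Rightarrow> 'w::ab_group_add \<Rightarrow> 'w) \<Rightarrow> ('u \<Rightarrow> 'u \<Rightarrow> 'w) \<Rightarrow> bool" where
  "bilinear_map s1 s2 f \<longleftrightarrow>
     (\<forall>x. Vector_Spaces.linear s1 s2 (\<lambda>y. f x y)) \<and> (\<forall>y. Vector_Spaces.linear s1 s2 (\<lambda>x. f x y))"

definition JJ_algebra ::
  "('k::field \<Rightarrow> 'v::ab_group_add \<Rightarrow> 'v) \<Rightarrow> ('v \<Rightarrow> 'v \<Rightarrow> 'v) \<Rightarrow> bool" where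
  "JJ_algebra scale mul \<longleftrightarrow>
     (\<exists>B. finite_dimensional_vector_space scale B) \<and>
     bilinear_map scale scale mul \<and>
     (\<forall>x y. mul x y = mul y x) \<and>
     (\<forall>x y z. mul x (mul y z) + mul y (mul z x) + mul z (mul x y) = 0)"

definition anti_derivation ::
  "('k::field \<Rightarrow> 'v::ab_group_add \<Rightarrow> 'v) \<Rightarrow> ('v \<Rightarrow> 'v \<Rightarrow> 'v) \<Rightarrow> ('v \<Rightarrow> 'v) \<Rightarrow> bool" where
  "anti_derivation scale mul D \<longleftrightarrow>
     Vector_Spaces.linear scale scale D \<and>
     (\<forall>x y. D (mul x y) = - mul (D x) y - mul x (D y))"

definition admissible_pair ::
  "('k::field \<Rightarrow> 'v::ab_group_add \<Rightarrow> 'v) \<Rightarrow> ('v \<Rightarrow> 'v \<Rightarrow> 'v) \<Rightarrow> ('v \<Rightarrow> 'v) \<Rightarrow> 'v \<Rightarrow> bool" where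
  "admissible_pair scale mul \<phi> a \<longleftrightarrow>
     anti_derivation scale mul \<phi> \<and>
     \<phi> a = 0 \<and>
     (\<forall>x. \<phi> (\<phi> x) = scale (- (1 / 2)) (mul a x))"

text \<open>
  If \<open>'k\<close> has positive characteristic \<open>p\<close>, then \<open>\<omega>\<^sup>m = 0\<close> for every alternating \<open>\<omega>\<close> and every
  \<open>m \<ge> p\<close>, because \<open>\<omega>\<^sup>m\<close> carries the factor \<open>m!\<close>. The non-vanishing condition below is therefore
  equivalent to the usual non-degeneracy of \<open>(\<alpha>, \<omega>)\<close> only if \<open>n!\<close> is non-zero in \<open>'k\<close>.
\<close>

definition cosymplectic ::
  "nat \<Rightarrow> ('k::field \<Rightarrow> 'v::ab_group_add \<Rightarrow> 'v) \<Rightarrow> ('v \<Rightarrow> 'v \<Rightarrow> 'v) \<Rightarrow>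
     ('v \<Rightarrow> 'k) \<Rightarrow> ('v \<Rightarrow> 'v \<Rightarrow> 'k) \<Rightarrow> bool" where
  "cosymplectic n scale mul \<alpha> \<omega> \<longleftrightarrow>
     JJ_algebra scale mul \<and>
     vector_space.dim scale UNIV = 2 * n + 1 \<and>
     Vector_Spaces.linear scale (*) \<alpha> \<and>
     bilinear_map scale (*) \<omega> \<and>
     (\<forall>x y. \<omega> x y = - \<omega> y x) \<and>
     wedge 1 (2 * n) (form1 \<alpha>) (wedge_power \<omega> n) \<noteq> (\<lambda>_. 0) \<and>
     (\<forall>x y. \<alpha> (mul x y) = 0) \<and>
     (\<forall>x y z. \<omega> (mul x y) z + \<omega> (mul z x) y + \<omega> (mul y z) x = 0)"


section \<open>The extension by \<open>d\<close> and \<open>e\<close>\<close>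

text \<open>The triple \<open>(s, x, r)\<close> stands for \<open>s d + x + r e\<close>.\<close>

type_synonym ('k, 'v) ext = "'k \<times> 'v \<times> 'k"

definition ext_scale ::
  "('k::field \<Rightarrow> 'v::ab_group_add \<Rightarrow> 'v) \<Rightarrow> 'k \<Rightarrow> ('k, 'v) ext \<Rightarrow> ('k, 'v) ext" where
  "ext_scale scale c = (\<lambda>(s, x, r). (c * s, scale c x, c * r))"

definition ext_d :: "('k::field, 'v::ab_group_add) ext" where "ext_d = (1, 0, 0)"
definition ext_e :: "('k::field, 'v::ab_group_add) ext" where "ext_e = (0, 0, 1)"
definition ext_in :: "'v \<Rightarrow> ('k::field, 'v::ab_group_add) ext" where "ext_in x = (0, x, 0)"

definition d_star :: "('k::field, 'v) ext \<Rightarrow> 'k" where "d_star u = fst u"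
definition e_star :: "('k::field, 'v) ext \<Rightarrow> 'k" where "e_star u = snd (snd u)"
definition ext_proj :: "('k::field, 'v) ext \<Rightarrow> 'v" where "ext_proj u = fst (snd u)"

definition omega_phi ::
  "('v \<Rightarrow> 'v \<Rightarrow> 'k::field) \<Rightarrow> ('v \<Rightarrow> 'v) \<Rightarrow> 'v \<Rightarrow> 'v \<Rightarrow> 'k" where
  "omega_phi \<omega> \<phi> x y = \<omega> (\<phi> x) y + \<omega> (\<phi> y) x"

text \<open>
  The bilinear extension of the products of \<open>d\<close>, \<open>e\<close> and elements of \<open>'v\<close> given in the lemmas
  \<open>ext_mult_in_in\<close>, \<open>ext_mult_d_in\<close>, \<open>ext_mult_d_d\<close> and \<open>ext_mult_e\<close> below.
\<close>

definition ext_mult ::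
  "('k::field \<Rightarrow> 'v::ab_group_add \<Rightarrow> 'v) \<Rightarrow> ('v \<Rightarrow> 'v \<Rightarrow> 'v) \<Rightarrow> ('v \<Rightarrow> 'v \<Rightarrow> 'k) \<Rightarrow>
     ('v \<Rightarrow> 'v) \<Rightarrow> 'v \<Rightarrow> ('k, 'v) ext \<Rightarrow> ('k, 'v) ext \<Rightarrow> ('k, 'v) ext" where
  "ext_mult scale mul \<omega> \<phi> a = (\<lambda>(s, x, _) (s', x', _).
     (0,
      mul x x' + scale s (\<phi> x') + scale s' (\<phi> x) + scale (s * s') a,
      omega_phi \<omega> \<phi> x x' + s * (1 / 2 * \<omega> a x') + s' * (1 / 2 * \<omega> a x)))"

definition wedge_lin :: "('u \<Rightarrow> 'k::field) \<Rightarrow> ('u \<Rightarrow> 'k) \<Rightarrow> 'u \<Rightarrow> 'u \<Rightarrow> 'k" where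
  "wedge_lin f g x y = f x * g y - f y * g x"

text \<open>
  Note that \<open>ext_alpha \<alpha> t\<close> takes the value \<open>\<alpha> a\<close> at the product of \<open>d\<close> with itself, and that
  the \<open>n + 1\<close>-st power of \<open>ext_omega \<omega>\<close> equals
  \<open>\<omega>\<^sup>n\<^sup>+\<^sup>1 + (n + 1) \<omega>\<^sup>n \<and> d_star \<and> e_star\<close>. Hence \<open>\<alpha> a = 0\<close> and the invertibility of \<open>n + 1\<close> in \<open>'k\<close>
  are both necessary for a cosymplectic structure on the extension.
\<close>

definition ext_alpha :: "('v \<Rightarrow> 'k::field) \<Rightarrow> 'k \<Rightarrow> ('k, 'v) ext \<Rightarrow> 'k" where
  "ext_alpha \<alpha> t u = \<alpha> (ext_proj u) + t * d_star u"

definition ext_omega ::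
  "('v \<Rightarrow> 'v \<Rightarrow> 'k::field) \<Rightarrow> ('k, 'v) ext \<Rightarrow> ('k, 'v) ext \<Rightarrow> 'k" where
  "ext_omega \<omega> u v = \<omega> (ext_proj u) (ext_proj v) + wedge_lin d_star e_star u v"

lemma bilinear_map_zero:
  assumes "bilinear_map s1 s2 f"
  shows "f 0 y = 0" "f x 0 = 0"
proof -
  interpret l: Vector_Spaces.linear s1 s2 "\<lambda>x. f x y"
    using assms by (simp add: bilinear_map_def)
  interpret r: Vector_Spaces.linear s1 s2 "\<lambda>y. f x y"
    using assms by (simp add: bilinear_map_def)
  show "f 0 y = 0" "f x 0 = 0"
    by (fact l.zero, fact r.zero)
qed

context
  fixes scale :: "'k::field \<Rightarrow> 'v::ab_group_add \<Rightarrow> 'v"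
    and mul :: "'v \<Rightarrow> 'v \<Rightarrow> 'v" and \<omega> :: "'v \<Rightarrow> 'v \<Rightarrow> 'k" and \<phi> :: "'v \<Rightarrow> 'v" and a :: 'v
  assumes mul: "bilinear_map scale scale mul" and \<omega>: "bilinear_map scale (*) \<omega>"
    and \<phi>: "Vector_Spaces.linear scale scale \<phi>"
begin

interpretation \<phi>: Vector_Spaces.linear scale scale \<phi> by (fact \<phi>)

interpretation vector_space scale by (fact \<phi>.vs1.vector_space_axioms)

lemmas zero_simps = bilinear_map_zero[OF mul] bilinear_map_zero[OF \<omega>] \<phi>.zero

lemma ext_decomp:
  "(s, x, r) = ext_scale scale s ext_d + ext_in x + ext_scale scale r ext_e"
  by (simp add: ext_scale_def ext_d_def ext_in_def ext_e_def)

lemma ext_mult_in_in: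
  "ext_mult scale mul \<omega> \<phi> a (ext_in x) (ext_in y) =
     ext_in (mul x y) + ext_scale scale (omega_phi \<omega> \<phi> x y) ext_e"
  by (simp add: ext_mult_def ext_in_def ext_e_def ext_scale_def zero_simps)

lemma ext_mult_d_in:
  "ext_mult scale mul \<omega> \<phi> a ext_d (ext_in x) =
     ext_in (\<phi> x) + ext_scale scale (1 / 2 * \<omega> a x) ext_e"
  by (simp add: ext_mult_def ext_in_def ext_d_def ext_e_def ext_scale_def omega_phi_def zero_simps)

lemma ext_mult_d_d: "ext_mult scale mul \<omega> \<phi> a ext_d ext_d = ext_in a"
  by (simp add: ext_mult_def ext_in_def ext_d_def omega_phi_def zero_simps)

lemma ext_mult_e: "ext_mult scale mul \<omega> \<phi> a u ext_e = 0"
  by (auto simp: ext_mult_def ext_e_def omega_phi_def zero_simps zero_prod_def split: prod.splits)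

end

end

theory Submission
  imports Defs "HOL-Analysis.Product_Vector"
begin

text \<open>
  The algebraic conditions on the extension reduce, by multilinearity, to identities in \<open>'v\<close>,
  one for each way of distributing \<open>d\<close> and elements of \<open>'v\<close> over the arguments; an argument \<open>e\<close>
  contributes \<open>0\<close> throughout. In the Jacobi identity the \<open>'v\<close>-component uses the Jacobi identity of \<open>mul\<close>, the anti-derivation rule and
  \<open>a \<cdot> x = - 2 \<phi> (\<phi> x)\<close>; the \<open>e\<close>-component uses that \<open>\<omega>\<close> is closed (\<open>omega_phi_cyclic\<close>,
  \<open>omega_phi_\<phi>\<close>). In the closedness of \<open>ext_omega \<omega>\<close> the values \<open>\<omega>_\<phi>(x, y)\<close> and
  \<open>\<omega>(a, x)\<close> that come from the \<open>'v\<close>-part of the products are cancelled by the \<open>e\<close>-part of the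
  products, paired with \<open>d\<close>.

  The substantial point is that \<open>\<alpha> \<and> \<omega>\<^sup>n \<noteq> 0\<close> implies \<open>\<alpha>' \<and> \<omega>'\<^sup>n\<^sup>+\<^sup>1 \<noteq> 0\<close> for the extended
  forms \<open>\<alpha>'\<close> and \<open>\<omega>'\<close>. Here \<open>(d, e)\<close> is a hyperbolic pair for \<open>\<omega>'\<close>, orthogonal to \<open>'v\<close>, and
  \<open>\<alpha>'(e) = 0\<close>. For arguments \<open>v\<close> in \<open>'v\<close> this gives
  \<open>(\<alpha>' \<and> \<omega>'\<^sup>n\<^sup>+\<^sup>1)(d, e, v) = (n + 1) (\<alpha> \<and> \<omega>\<^sup>n)(v)\<close> (\<open>wedge_form1_hyperbolic_pair\<close>), and \<open>n + 1\<close> is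
  invertible by assumption.

  This identity follows by contracting with \<open>d\<close> and then with \<open>e\<close>. The tool is the rule that
  contraction is an anti-derivation of the wedge product (\<open>wedge_case_nat\<close>): with
  \<open>\<omega>'\<^sup>m\<^sup>+\<^sup>1 = \<omega>' \<and> \<omega>'\<^sup>m\<close> it yields the contracted powers by induction on \<open>m\<close>.
\<close>

section \<open>Shuffles and the first argument\<close>

definition lift_perm :: "(nat \<Rightarrow> nat) \<Rightarrow> nat \<Rightarrow> nat" where
  "lift_perm \<tau> = case_nat 0 (\<lambda>j. Suc (\<tau> j))"

lemma lift_perm_simps [simp]: "lift_perm \<tau> 0 = 0" "lift_perm \<tau> (Suc j) = Suc (\<tau> j)"
  by (simp_all add: lift_perm_def)

lemma inj_lift_perm: "inj lift_perm"
proof (rule injI)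
  fix \<sigma> \<tau> assume "lift_perm \<sigma> = lift_perm \<tau>"
  then have "lift_perm \<sigma> (Suc j) = lift_perm \<tau> (Suc j)" for j
    by simp
  then show "\<sigma> = \<tau>"
    by (simp add: fun_eq_iff)
qed

lemma lift_perm_id: "lift_perm id = id"
  by (auto simp: lift_perm_def fun_eq_iff split: nat.split)

lemma lift_perm_comp: "lift_perm (\<sigma> \<circ> \<tau>) = lift_perm \<sigma> \<circ> lift_perm \<tau>"
  by (auto simp: lift_perm_def fun_eq_iff split: nat.split)

lemma lift_perm_transpose: "lift_perm (transpose i j) = transpose (Suc i) (Suc j)"
  by (auto simp: lift_perm_def fun_eq_iff transpose_def split: nat.split)

lemma lift_perm_permutes:
  assumes "\<tau> permutes {..<n}"
  shows "lift_perm \<tau> permutes {..<Suc n}"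
proof (rule bij_imp_permutes)
  have "inj_on (lift_perm \<tau>) {..<Suc n}"
    using permutes_inj[OF assms] by (auto simp: inj_on_def lift_perm_def dest: injD split: nat.splits)
  moreover have "lift_perm \<tau> ` {..<Suc n} = {..<Suc n}"
    unfolding lessThan_Suc_eq_insert_0 using permutes_image[OF assms]
    by (simp add: image_image) (simp flip: image_image)
  ultimately show "bij_betw (lift_perm \<tau>) {..<Suc n} {..<Suc n}"
    by (simp add: bij_betw_def)
  show "lift_perm \<tau> i = i" if "i \<notin> {..<Suc n}" for i
    using that permutes_not_in[OF assms] by (cases i) auto
qed

lemma sign_lift_perm:
  assumes "\<tau> permutes {..<n}"
  shows "sign (lift_perm \<tau>) = sign \<tau>"
  using assms finite_lessThan
proof (induction rule: permutes_induct)
  case id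
  show ?case by (simp only: lift_perm_id)
next
  case (swap i j \<tau>)
  have "permutation \<tau>"
    using swap.hyps by (auto simp: permutation_permutes)
  moreover have "permutation (lift_perm \<tau>)"
    using lift_perm_permutes[of \<tau> n] swap.hyps by (auto simp: permutation_permutes)
  ultimately show ?case
    using swap.IH by (simp add: lift_perm_comp lift_perm_transpose sign_compose
        permutation_swap_id sign_swap_id del: o_apply)
qed

lemma permutes_fixing_0_is_lift:
  assumes \<sigma>: "\<sigma> permutes {..<Suc n}" and 0: "\<sigma> 0 = 0"
  obtains \<tau> where "\<tau> permutes {..<n}" "\<sigma> = lift_perm \<tau>"
proof
  let ?\<tau> = "\<lambda>j. \<sigma> (Suc j) - 1"
  have pos: "\<sigma> (Suc j) > 0" for j
    using injD[OF permutes_inj[OF \<sigma>], of "Suc j" 0] 0 by fastforce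
  show eq: "\<sigma> = lift_perm ?\<tau>"
    using pos 0 by (auto simp: fun_eq_iff lift_perm_def split: nat.split)
  show "?\<tau> permutes {..<n}"
  proof (rule bij_imp_permutes)
    have "inj_on ?\<tau> {..<n}"
      using injD[OF permutes_inj[OF \<sigma>]] pos
      by (intro inj_onI) (metis Suc_pred' diff_Suc_1 One_nat_def old.nat.inject)
    moreover have "?\<tau> ` {..<n} \<subseteq> {..<n}"
    proof clarsimp
      fix j assume "j < n"
      then have "\<sigma> (Suc j) < Suc n"
        using permutes_in_image[OF \<sigma>, of "Suc j"] by simp
      then show "\<sigma> (Suc j) - Suc 0 < n"
        using pos[of j] by linarith
    qed
    ultimately show "bij_betw ?\<tau> {..<n} {..<n}"
      by (simp add: bij_betw_def endo_inj_surj)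
    show "?\<tau> j = j" if "j \<notin> {..<n}" for j
      using that permutes_not_in[OF \<sigma>, of "Suc j"] by simp
  qed
qed

text \<open>
  The cycle that moves position \<open>k\<close> to the front and shifts the positions before it by one.
\<close>

definition to_front :: "nat \<Rightarrow> nat \<Rightarrow> nat" where
  "to_front k i = (if i < k then Suc i else if i = k then 0 else i)"

lemma to_front_Suc: "to_front (Suc k) = to_front k \<circ> transpose k (Suc k)"
  by (auto simp: to_front_def fun_eq_iff transpose_def)

lemma to_front_permutes: "to_front k permutes {..k}"
proof (induction k)
  case 0
  have "to_front 0 = id" by (auto simp: to_front_def)
  then show ?case by (simp only: permutes_id)
next
  case (Suc k)
  have "to_front k permutes {..Suc k}"
    by (rule permutes_subset[OF Suc.IH]) auto
  moreover have "transpose k (Suc k) permutes {..Suc k}"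
    by (rule permutes_swap_id) auto
  ultimately show ?case
    unfolding to_front_Suc by (rule permutes_compose[rotated])
qed

lemma sign_to_front: "sign (to_front k) = (- 1) ^ k"
proof (induction k)
  case 0
  have "to_front 0 = id" by (auto simp: to_front_def)
  then show ?case by (simp only: sign_id power_0)
next
  case (Suc k)
  have "permutation (to_front k)"
    using to_front_permutes[of k] by (auto simp: permutation_permutes)
  then show ?case
    using Suc.IH by (simp add: to_front_Suc sign_compose permutation_swap_id sign_swap_id del: o_apply)
qed


lemma to_front_simps:
  "i < k \<Longrightarrow> to_front k i = Suc i" "to_front k k = 0" "to_front k (k + Suc j) = k + Suc j"
  by (simp_all add: to_front_def)

lemma lift_perm_in_shuffle_perms_iff:
  assumes "\<tau> permutes {..<k + l}"
  shows "lift_perm \<tau> \<in> shuffle_perms (Suc k) l \<longleftrightarrow> \<tau> \<in> shuffle_perms k l"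
proof -
  have "strict_mono_on {..<Suc k} (lift_perm \<tau>) \<longleftrightarrow> strict_mono_on {..<k} \<tau>"
    unfolding strict_mono_on_def by (auto simp: lift_perm_def split: nat.split)
  moreover have "strict_mono_on {Suc k..<Suc k + l} (lift_perm \<tau>) \<longleftrightarrow> strict_mono_on {k..<k + l} \<tau>"
    unfolding strict_mono_on_def by (auto simp: lift_perm_def split: nat.split)
  ultimately show ?thesis
    using assms lift_perm_permutes[OF assms] by (simp add: shuffle_perms_def)
qed

lemma lift_perm_to_front_permutes:
  assumes "\<tau> permutes {..<k + l}"
  shows "lift_perm \<tau> \<circ> to_front k permutes {..<k + Suc l}"
proof (rule permutes_compose)
  show "to_front k permutes {..<k + Suc l}"
    by (rule permutes_subset[OF to_front_permutes]) auto
  show "lift_perm \<tau> permutes {..<k + Suc l}"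
    using lift_perm_permutes[OF assms] by simp
qed

lemma lift_perm_to_front_in_shuffle_perms_iff:
  assumes "\<tau> permutes {..<k + l}"
  shows "lift_perm \<tau> \<circ> to_front k \<in> shuffle_perms k (Suc l) \<longleftrightarrow> \<tau> \<in> shuffle_perms k l"
proof -
  let ?\<sigma> = "lift_perm \<tau> \<circ> to_front k"
  have "strict_mono_on {..<k} ?\<sigma> \<longleftrightarrow> strict_mono_on {..<k} \<tau>"
    unfolding strict_mono_on_def by (auto simp: to_front_simps)
  moreover have "strict_mono_on {k..<k + Suc l} ?\<sigma> \<longleftrightarrow> strict_mono_on {k..<k + l} \<tau>"
  proof
    assume *: "strict_mono_on {k..<k + Suc l} ?\<sigma>"
    show "strict_mono_on {k..<k + l} \<tau>"
    proof (rule strict_mono_onI)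
      fix r s assume "r \<in> {k..<k + l}" "s \<in> {k..<k + l}" "r < s"
      then have "?\<sigma> (Suc r) < ?\<sigma> (Suc s)"
        by (intro strict_mono_onD[OF *]) auto
      then show "\<tau> r < \<tau> s"
        using \<open>r \<in> _\<close> \<open>s \<in> _\<close> by (simp add: to_front_def)
    qed
  next
    assume *: "strict_mono_on {k..<k + l} \<tau>"
    show "strict_mono_on {k..<k + Suc l} ?\<sigma>"
    proof (rule strict_mono_onI)
      fix r s assume rs: "r \<in> {k..<k + Suc l}" "s \<in> {k..<k + Suc l}" "r < s"
      then obtain s' where s': "s = Suc s'" "k \<le> s'"
        by (cases s) auto
      show "?\<sigma> r < ?\<sigma> s"
      proof (cases "r = k")
        case True
        then show ?thesis using s' by (simp add: to_front_def)
      next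
        case False
        then obtain r' where r': "r = Suc r'" "k \<le> r'"
          using rs by (cases r) auto
        have "\<tau> r' < \<tau> s'"
          using rs r' s' by (intro strict_mono_onD[OF *]) auto
        then show ?thesis
          using r' s' by (simp add: to_front_def)
      qed
    qed
  qed
  ultimately show ?thesis
    using assms lift_perm_to_front_permutes[OF assms] by (simp add: shuffle_perms_def)
qed

text \<open>
  The recursion behind Pascal's rule. By monotonicity on the two blocks, the value \<open>0\<close> of a
  shuffle is taken at the start of the first block or at the start of the second block. Deleting it
  leaves a shuffle of a smaller type. In the second case the start of the second block, position
  \<open>Suc k\<close>, is first brought to the front, which contributes the sign \<open>(- 1) ^ Suc k\<close>.
\<close>

lemma shuffle_perms_Suc_Suc:
  "shuffle_perms (Suc k) (Suc l) =
     lift_perm ` shuffle_perms k (Suc l) \<union> (\<lambda>\<tau>. lift_perm \<tau> \<circ> to_front (Suc k)) ` shuffle_perms (Suc k) l"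
    (is "_ = ?A \<union> ?B")
proof
  have "?A \<subseteq> shuffle_perms (Suc k) (Suc l)"
    using lift_perm_in_shuffle_perms_iff[of _ k "Suc l"] by (auto simp: shuffle_perms_def)
  moreover have "?B \<subseteq> shuffle_perms (Suc k) (Suc l)"
    using lift_perm_to_front_in_shuffle_perms_iff[of _ "Suc k" l] by (auto simp: shuffle_perms_def)
  ultimately show "?A \<union> ?B \<subseteq> shuffle_perms (Suc k) (Suc l)"
    by blast
  show "shuffle_perms (Suc k) (Suc l) \<subseteq> ?A \<union> ?B"
  proof
    fix \<sigma> assume \<sigma>: "\<sigma> \<in> shuffle_perms (Suc k) (Suc l)"
    then have perm: "\<sigma> permutes {..<Suc (Suc (k + l))}"
      and mono1: "strict_mono_on {..<Suc k} \<sigma>"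
      and mono2: "strict_mono_on {Suc k..<Suc k + Suc l} \<sigma>"
      by (simp_all add: shuffle_perms_def)
    obtain p where p: "p \<in> {..<Suc (Suc (k + l))}" "\<sigma> p = 0"
      using permutes_image[OF perm] by (metis imageE lessThan_iff zero_less_Suc)
    show "\<sigma> \<in> ?A \<union> ?B"
    proof (cases "p < Suc k")
      case True
      have "p = 0"
        using strict_mono_onD[OF mono1, of 0 p] True p(2) by fastforce
      then obtain \<tau> where \<tau>: "\<tau> permutes {..<Suc (k + l)}" "\<sigma> = lift_perm \<tau>"
        using permutes_fixing_0_is_lift[OF perm] p(2) by blast
      then have "\<tau> \<in> shuffle_perms k (Suc l)"
        using lift_perm_in_shuffle_perms_iff[of \<tau> k "Suc l"] \<sigma> by simp
      then show ?thesis using \<tau>(2) by blast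
    next
      case False
      have "p = Suc k"
        using strict_mono_onD[OF mono2, of "Suc k" p] False p by fastforce
      let ?c = "to_front (Suc k)"
      have c: "?c permutes {..<Suc (Suc (k + l))}"
        by (rule permutes_subset[OF to_front_permutes]) auto
      have "inv ?c 0 = p"
        using permutes_inv_eq[OF c, of 0 p] \<open>p = Suc k\<close> by (simp add: to_front_simps)
      then have "(\<sigma> \<circ> inv ?c) 0 = 0"
        using p by simp
      moreover have "\<sigma> \<circ> inv ?c permutes {..<Suc (Suc (k + l))}"
        by (rule permutes_compose[OF permutes_inv[OF c] perm])
      ultimately obtain \<tau> where \<tau>: "\<tau> permutes {..<Suc (k + l)}" "\<sigma> \<circ> inv ?c = lift_perm \<tau>"
        using permutes_fixing_0_is_lift by blast
      have "lift_perm \<tau> \<circ> ?c = \<sigma>"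
        using permutes_inv_o(2)[OF c] by (simp add: comp_assoc flip: \<tau>(2))
      moreover from this have "\<tau> \<in> shuffle_perms (Suc k) l"
        using lift_perm_to_front_in_shuffle_perms_iff[of \<tau> "Suc k" l] \<sigma> \<tau>(1) by simp
      ultimately show ?thesis by blast
    qed
  qed
qed

lemma finite_shuffle_perms: "finite (shuffle_perms k l)"
  by (rule finite_subset[OF _ finite_permutations[of "{..<k + l}"]]) (auto simp: shuffle_perms_def)

text \<open>
  Write \<open>\<iota>\<^sub>x f\<close> for the contraction \<open>\<lambda>u. f (case_nat x u)\<close>. The lemma is the anti-derivation rule
  \<open>\<iota>\<^sub>x (f \<and> g) = \<iota>\<^sub>x f \<and> g + (- 1)\<^sup>k f \<and> \<iota>\<^sub>x g\<close> for a form \<open>f\<close> of degree \<open>k\<close>, with \<open>Suc k\<close> in place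
  of \<open>k\<close>. The two summands are the two kinds of shuffles: \<open>x\<close> becomes the first argument of \<open>f\<close> or
  the first argument of \<open>g\<close>. The form \<open>f\<close> must
  read its own arguments only, because the cycle \<open>to_front\<close> changes the later ones.
\<close>

lemma wedge_case_nat:
  assumes f: "\<And>u u'. (\<And>i. i < Suc k \<Longrightarrow> u i = u' i) \<Longrightarrow> f u = f u'"
  shows "wedge (Suc k) (Suc l) f g (case_nat x v) =
    wedge k (Suc l) (\<lambda>u. f (case_nat x u)) g v +
    (- 1) ^ Suc k * wedge (Suc k) l f (\<lambda>u. g (case_nat x u)) v"
proof -
  let ?c = "to_front (Suc k)"
  let ?h = "\<lambda>\<sigma>. of_int (sign \<sigma>) * f (\<lambda>i. case_nat x v (\<sigma> i)) * g (\<lambda>i. case_nat x v (\<sigma> (Suc k + i)))"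
  let ?A = "shuffle_perms k (Suc l)" and ?B = "shuffle_perms (Suc k) l"
  have inj: "inj (\<lambda>\<tau>. lift_perm \<tau> \<circ> ?c)"
  proof (rule injI)
    fix \<sigma> \<tau> assume "lift_perm \<sigma> \<circ> ?c = lift_perm \<tau> \<circ> ?c"
    then have "lift_perm \<sigma> (?c i) = lift_perm \<tau> (?c i)" for i
      by (metis comp_apply)
    then have "lift_perm \<sigma> = lift_perm \<tau>"
      using permutes_surj[OF to_front_permutes[of "Suc k"]] by (metis ext surjD)
    then show "\<sigma> = \<tau>"
      by (rule injD[OF inj_lift_perm])
  qed
  have "lift_perm \<tau> \<noteq> lift_perm \<tau>' \<circ> ?c" for \<tau> \<tau>'
  proof
    assume "lift_perm \<tau> = lift_perm \<tau>' \<circ> ?c"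
    then have "lift_perm \<tau> 0 = (lift_perm \<tau>' \<circ> ?c) 0"
      by simp
    then show False
      by (simp add: to_front_simps)
  qed
  then have disj: "lift_perm ` ?A \<inter> (\<lambda>\<tau>. lift_perm \<tau> \<circ> ?c) ` ?B = {}"
    by blast
  have "wedge (Suc k) (Suc l) f g (case_nat x v) =
      sum ?h (lift_perm ` ?A) + sum ?h ((\<lambda>\<tau>. lift_perm \<tau> \<circ> ?c) ` ?B)"
    unfolding wedge_def shuffle_perms_Suc_Suc
    by (rule sum.union_disjoint) (use disj finite_shuffle_perms in auto)
  also have "sum ?h (lift_perm ` ?A) = (\<Sum>\<tau>\<in>?A. ?h (lift_perm \<tau>))"
    by (subst sum.reindex[OF inj_on_subset[OF inj_lift_perm subset_UNIV]]) (simp add: comp_def)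
  also have "\<dots> = wedge k (Suc l) (\<lambda>u. f (case_nat x u)) g v"
    unfolding wedge_def
  proof (rule sum.cong[OF refl])
    fix \<tau> assume "\<tau> \<in> ?A"
    then have "sign (lift_perm \<tau>) = sign \<tau>"
      by (intro sign_lift_perm[of _ "k + Suc l"]) (simp add: shuffle_perms_def)
    moreover have "(\<lambda>i. case_nat x v (lift_perm \<tau> i)) = case_nat x (\<lambda>i. v (\<tau> i))"
      by (auto simp: fun_eq_iff lift_perm_def split: nat.split)
    ultimately show "?h (lift_perm \<tau>) =
        of_int (sign \<tau>) * f (case_nat x (\<lambda>i. v (\<tau> i))) * g (\<lambda>i. v (\<tau> (k + i)))"
      by simp
  qed
  also have "sum ?h ((\<lambda>\<tau>. lift_perm \<tau> \<circ> ?c) ` ?B) = (\<Sum>\<tau>\<in>?B. ?h (lift_perm \<tau> \<circ> ?c))"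
    by (subst sum.reindex[OF inj_on_subset[OF inj subset_UNIV]]) (simp add: comp_def)
  also have "\<dots> = (- 1) ^ Suc k * wedge (Suc k) l f (\<lambda>u. g (case_nat x u)) v"
    unfolding wedge_def sum_distrib_left
  proof (rule sum.cong[OF refl])
    fix \<tau> assume "\<tau> \<in> ?B"
    then have perm: "\<tau> permutes {..<Suc k + l}"
      by (simp add: shuffle_perms_def)
    have "permutation (lift_perm \<tau>)" "permutation ?c"
      using lift_perm_permutes[OF perm] to_front_permutes by (auto simp: permutation_permutes)
    then have "sign (lift_perm \<tau> \<circ> ?c) = (- 1) ^ Suc k * sign \<tau>"
      by (simp add: sign_compose sign_to_front sign_lift_perm[OF perm])
    moreover have "f (\<lambda>i. case_nat x v ((lift_perm \<tau> \<circ> ?c) i)) = f (\<lambda>i. v (\<tau> i))"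
      by (rule f) (simp add: to_front_simps)
    moreover have "(\<lambda>i. case_nat x v ((lift_perm \<tau> \<circ> ?c) (Suc k + i))) = case_nat x (\<lambda>i. v (\<tau> (Suc k + i)))"
      by (auto simp: fun_eq_iff to_front_def split: nat.split)
    ultimately show "?h (lift_perm \<tau> \<circ> ?c) = (- 1) ^ Suc k *
        (of_int (sign \<tau>) * f (\<lambda>i. v (\<tau> i)) * g (case_nat x (\<lambda>i. v (\<tau> (Suc k + i)))))"
      by simp
  qed
  finally show ?thesis .
qed

text \<open>
  Contraction stops when one of the degrees is \<open>0\<close>. Then the identity is the only shuffle.
\<close>

lemma permutes_strict_mono_on_lessThan:
  assumes \<sigma>: "\<sigma> permutes {..<n::nat}" and mono: "strict_mono_on {..<n} \<sigma>"
  shows "\<sigma> = id"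
proof -
  have ge: "i \<le> \<sigma> i" if "i < n" for i
    using that
  proof (induction i)
    case (Suc i)
    then have "\<sigma> i < \<sigma> (Suc i)"
      by (intro strict_mono_onD[OF mono]) auto
    then show ?case
      using Suc by simp
  qed simp
  have "\<sigma> i = i" for i
    using permutes_natset_ge[of \<sigma> "{..<n}"] \<sigma> ge by auto
  then show ?thesis by auto
qed

lemma shuffle_perms_0: "shuffle_perms 0 l = {id}" "shuffle_perms k 0 = {id}"
  using permutes_strict_mono_on_lessThan
  by (auto simp: shuffle_perms_def permutes_id strict_mono_on_id lessThan_atLeast0)

lemma wedge_0_left: "wedge 0 l f g v = f v * g v"
  by (simp add: wedge_def shuffle_perms_0)

lemma wedge_0_right: "wedge k 0 f g v = f v * g (\<lambda>i. v (k + i))"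
  by (simp add: wedge_def shuffle_perms_0)


section \<open>Wedge powers and hyperbolic pairs\<close>

text \<open>
  Restricting a form to a subspace is pulling it back along the inclusion \<open>h\<close>. A form that vanishes
  on the subspace is thereby replaced by \<open>0\<close> inside a wedge product.
\<close>

lemma wedge_pullback:
  "wedge k l f g (\<lambda>i. h (v i)) = wedge k l (\<lambda>u. f (\<lambda>i. h (u i))) (\<lambda>u. g (\<lambda>i. h (u i))) v"
  by (simp add: wedge_def)

lemma wedge_zero:
  "wedge k l (\<lambda>_. 0) g v = 0" "wedge k l f (\<lambda>_. 0) v = 0"
  by (simp_all add: wedge_def)

lemma wedge_scale_right: "wedge k l f (\<lambda>u. c * g u) v = c * wedge k l f g v"
  by (simp add: wedge_def sum_distrib_left mult_ac)

lemma wedge_form2_case_nat: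
  "wedge 2 (Suc l) (form2 \<omega>) g (case_nat x v) =
     wedge 1 (Suc l) (form1 (\<omega> x)) g v + wedge 2 l (form2 \<omega>) (\<lambda>u. g (case_nat x u)) v"
proof -
  have "(\<lambda>u. form2 \<omega> (case_nat x u)) = form1 (\<omega> x)"
    by (simp add: form1_def form2_def fun_eq_iff)
  then show ?thesis
    using wedge_case_nat[of 1 "form2 \<omega>" l g x v] by (simp add: form2_def numeral_2_eq_2)
qed

lemma wedge_form1_case_nat:
  "wedge 1 (Suc l) (form1 \<alpha>) g (case_nat x v) =
     \<alpha> x * g v - wedge 1 l (form1 \<alpha>) (\<lambda>u. g (case_nat x u)) v"
proof -
  have "(\<lambda>u. form1 \<alpha> (case_nat x u)) = (\<lambda>_. \<alpha> x)"
    by (simp add: form1_def fun_eq_iff)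
  then show ?thesis
    using wedge_case_nat[of 0 "form1 \<alpha>" l g x v] by (simp add: form1_def wedge_0_left)
qed

lemma wedge_power_pullback:
  assumes "\<And>x y. \<Omega> (h x) (h y) = \<omega> x y"
  shows "wedge_power \<Omega> m (\<lambda>i. h (v i)) = wedge_power \<omega> m v"
proof (induction m arbitrary: v)
  case (Suc m)
  have "(\<lambda>u. form2 \<Omega> (\<lambda>i. h (u i))) = form2 \<omega>"
    by (simp add: form2_def assms fun_eq_iff)
  then show ?case
    by (simp add: wedge_pullback Suc.IH)
qed simp

text \<open>
  By the anti-derivation rule, every term of the contraction of \<open>\<Omega>\<^sup>m\<^sup>+\<^sup>1\<close> with \<open>w\<close> has the factor
  \<open>\<Omega>(w, \<cdot>)\<close>, which vanishes on the range of \<open>h\<close>.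
\<close>

lemma wedge_power_orthogonal:
  assumes "\<And>x. \<Omega> w (h x) = 0"
  shows "wedge_power \<Omega> (Suc m) (case_nat w (\<lambda>i. h (v i))) = 0"
proof (induction m arbitrary: v)
  case 0
  then show ?case by (simp add: wedge_0_right form2_def assms)
next
  case (Suc m)
  have "(\<lambda>u. form1 (\<Omega> w) (\<lambda>i. h (u i))) = (\<lambda>_. 0)"
    by (simp add: form1_def assms)
  moreover have "wedge_power \<Omega> (Suc (Suc m)) (case_nat w (\<lambda>i. h (v i))) =
      wedge 1 (2 * Suc m) (form1 (\<Omega> w)) (wedge_power \<Omega> (Suc m)) (\<lambda>i. h (v i)) +
      wedge 2 (Suc (2 * m)) (form2 \<Omega>) (\<lambda>u. wedge_power \<Omega> (Suc m) (case_nat w u)) (\<lambda>i. h (v i))"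
    using wedge_form2_case_nat[of "Suc (2 * m)" \<Omega> "wedge_power \<Omega> (Suc m)" w "\<lambda>i. h (v i)"]
    by simp
  ultimately show ?case
    by (simp only: wedge_pullback Suc.IH wedge_zero) simp
qed

text \<open>
  On the range of \<open>h\<close>, contracting \<open>\<Omega> \<and> \<Omega>\<^sup>m\<^sup>+\<^sup>1\<close> with \<open>d\<close> and \<open>e\<close> leaves two terms: \<open>\<Omega>(d, e) \<Omega>\<^sup>m\<^sup>+\<^sup>1\<close>,
  which restricts to \<open>\<omega>\<^sup>m\<^sup>+\<^sup>1\<close>, and \<open>\<Omega>\<close> times the contraction of \<open>\<Omega>\<^sup>m\<^sup>+\<^sup>1\<close>, which restricts to
  \<open>(m + 1) \<omega> \<and> \<omega>\<^sup>m\<close> by induction. The mixed terms contain \<open>\<Omega>(d, \<cdot>)\<close> or \<open>\<Omega>(e, \<cdot>)\<close> as a factor and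
  vanish there.
\<close>

lemma wedge_power_hyperbolic_pair:
  assumes d: "\<And>x. \<Omega> d (h x) = 0" and e: "\<And>x. \<Omega> e (h x) = 0" and de: "\<Omega> d e = 1"
    and h: "\<And>x y. \<Omega> (h x) (h y) = \<omega> x y"
  shows "wedge_power \<Omega> (Suc m) (case_nat d (case_nat e (\<lambda>i. h (v i)))) =
    of_nat (Suc m) * wedge_power \<omega> m v"
proof (induction m arbitrary: v)
  case 0
  then show ?case by (simp add: wedge_0_right form2_def de)
next
  case (Suc m)
  let ?P = "wedge_power \<Omega> (Suc m)" and ?hv = "\<lambda>i. h (v i)"
  have 0: "(\<lambda>u. form1 (\<Omega> d) (\<lambda>i. h (u i))) = (\<lambda>_. 0)" "(\<lambda>u. form1 (\<Omega> e) (\<lambda>i. h (u i))) = (\<lambda>_. 0)"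
    by (simp_all add: form1_def d e)
  have \<omega>: "(\<lambda>u. form2 \<Omega> (\<lambda>i. h (u i))) = form2 \<omega>"
    by (simp add: form2_def h fun_eq_iff)
  have "wedge_power \<Omega> (Suc (Suc m)) (case_nat d (case_nat e ?hv)) =
      wedge 1 (Suc (Suc (2 * m))) (form1 (\<Omega> d)) ?P (case_nat e ?hv) +
      wedge 2 (Suc (2 * m)) (form2 \<Omega>) (\<lambda>u. ?P (case_nat d u)) (case_nat e ?hv)"
    using wedge_form2_case_nat[of "Suc (2 * m)" \<Omega> ?P d] by simp
  also have "wedge 1 (Suc (Suc (2 * m))) (form1 (\<Omega> d)) ?P (case_nat e ?hv) = ?P ?hv"
    by (simp only: wedge_form1_case_nat de wedge_pullback 0 wedge_zero) simp
  also have "?P ?hv = wedge_power \<omega> (Suc m) v"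
    by (rule wedge_power_pullback) (rule h)
  also have "wedge 2 (Suc (2 * m)) (form2 \<Omega>) (\<lambda>u. ?P (case_nat d u)) (case_nat e ?hv) =
      wedge 2 (2 * m) (form2 \<omega>) (\<lambda>u. of_nat (Suc m) * wedge_power \<omega> m u) v"
    by (simp only: wedge_form2_case_nat wedge_pullback 0 wedge_zero \<omega> Suc.IH) simp
  also have "\<dots> = of_nat (Suc m) * wedge_power \<omega> (Suc m) v"
    by (simp add: wedge_scale_right)
  finally show ?case
    by (simp add: algebra_simps)
qed

text \<open>
  In the double contraction, \<open>A d\<close> multiplies the contraction of \<open>\<Omega>\<^sup>n\<^sup>+\<^sup>1\<close> with \<open>e\<close>, which vanishes
  on the range of \<open>h\<close>. What remains is \<open>A\<close> times the double contraction of \<open>\<Omega>\<^sup>n\<^sup>+\<^sup>1\<close>.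
\<close>

lemma wedge_form1_hyperbolic_pair:
  assumes d: "\<And>x. \<Omega> d (h x) = 0" and e: "\<And>x. \<Omega> e (h x) = 0" and de: "\<Omega> d e = 1"
    and h: "\<And>x y. \<Omega> (h x) (h y) = \<omega> x y"
    and Ae: "A e = 0" and Ah: "\<And>x. A (h x) = \<alpha> x"
  shows "wedge 1 (2 * Suc n) (form1 A) (wedge_power \<Omega> (Suc n)) (case_nat d (case_nat e (\<lambda>i. h (v i)))) =
    of_nat (Suc n) * wedge 1 (2 * n) (form1 \<alpha>) (wedge_power \<omega> n) v"
proof -
  let ?P = "wedge_power \<Omega> (Suc n)" and ?hv = "\<lambda>i. h (v i)"
  have \<alpha>: "(\<lambda>u. form1 A (\<lambda>i. h (u i))) = form1 \<alpha>"
    by (simp add: form1_def Ah fun_eq_iff)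
  have "wedge 1 (2 * Suc n) (form1 A) ?P (case_nat d (case_nat e ?hv)) =
      A d * ?P (case_nat e ?hv) -
      wedge 1 (Suc (2 * n)) (form1 A) (\<lambda>u. ?P (case_nat d u)) (case_nat e ?hv)"
    using wedge_form1_case_nat[of "Suc (2 * n)" A ?P d] by simp
  also have "?P (case_nat e ?hv) = 0"
    by (rule wedge_power_orthogonal) (rule e)
  also have "wedge 1 (Suc (2 * n)) (form1 A) (\<lambda>u. ?P (case_nat d u)) (case_nat e ?hv) =
      - wedge 1 (2 * n) (form1 \<alpha>) (\<lambda>u. of_nat (Suc n) * wedge_power \<omega> n u) v"
    by (simp only: wedge_form1_case_nat Ae wedge_pullback \<alpha>
        wedge_power_hyperbolic_pair[of \<Omega> d h e \<omega>, OF d e de h]) simp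
  also have "\<dots> = - (of_nat (Suc n) * wedge 1 (2 * n) (form1 \<alpha>) (wedge_power \<omega> n) v)"
    by (simp only: wedge_scale_right)
  finally show ?thesis by simp
qed

section \<open>Linear algebra of the extension\<close>

lemma finite_dimensional_over_itself: "finite_dimensional_vector_space ((*) :: 'k::field \<Rightarrow> 'k \<Rightarrow> 'k) {1}"
proof -
  interpret vector_space "(*) :: 'k \<Rightarrow> 'k \<Rightarrow> 'k"
    by unfold_locales (auto simp: algebra_simps)
  show ?thesis
  proof
    show "span {1::'k} = UNIV"
      by (auto simp: span_singleton)
  qed auto
qed

lemma ext_finite_dimensional:
  fixes scale :: "'k::field \<Rightarrow> 'v::ab_group_add \<Rightarrow> 'v"
  assumes "finite_dimensional_vector_space scale B"
  shows "\<exists>B'. finite_dimensional_vector_space (ext_scale scale) B'"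
    and "vector_space.dim (ext_scale scale) UNIV = vector_space.dim scale UNIV + 2"
proof -
  interpret V: finite_dimensional_vector_space scale B by fact
  interpret K: finite_dimensional_vector_space "(*) :: 'k \<Rightarrow> 'k \<Rightarrow> 'k" "{1}"
    by (rule finite_dimensional_over_itself)
  interpret VK: finite_dimensional_vector_space_prod scale "(*) :: 'k \<Rightarrow> 'k \<Rightarrow> 'k" B "{1}" ..
  interpret KVK: finite_dimensional_vector_space_prod "(*) :: 'k \<Rightarrow> 'k \<Rightarrow> 'k" VK.scale "{1}" VK.Basis_pair ..
  have eq: "ext_scale scale = KVK.scale"
    by (auto simp: fun_eq_iff ext_scale_def KVK.scale_def VK.scale_def)
  show "\<exists>B'. finite_dimensional_vector_space (ext_scale scale) B'"
    unfolding eq using KVK.p.finite_dimensional_vector_space_axioms by blast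
  have "K.dim UNIV = 1"
    by (simp add: K.dim_UNIV)
  moreover have "VK.p.dim UNIV = V.dim UNIV + K.dim UNIV"
    using VK.dim_Times[OF V.subspace_UNIV K.subspace_UNIV] by simp
  moreover have "KVK.p.dim UNIV = K.dim UNIV + VK.p.dim UNIV"
    using KVK.dim_Times[OF K.subspace_UNIV VK.p.subspace_UNIV] by simp
  ultimately show "vector_space.dim (ext_scale scale) UNIV = V.dim UNIV + 2"
    unfolding eq by simp
qed

lemma bilinear_map_simps:
  assumes "bilinear_map s1 s2 f"
  shows "f (x + x') y = f x y + f x' y" "f x (y + y') = f x y + f x y'"
    and "f (- x) y = - f x y" "f x (- y) = - f x y"
    and "f (x - x') y = f x y - f x' y" "f x (y - y') = f x y - f x y'"
    and "f (s1 c x) y = s2 c (f x y)" "f x (s1 c y) = s2 c (f x y)"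
    and "f 0 y = 0" "f x 0 = 0"
proof -
  interpret l: Vector_Spaces.linear s1 s2 "\<lambda>x. f x y" for y
    using assms by (simp add: bilinear_map_def)
  interpret r: Vector_Spaces.linear s1 s2 "\<lambda>y. f x y" for x
    using assms by (simp add: bilinear_map_def)
  show "f (x + x') y = f x y + f x' y" "f x (y + y') = f x y + f x y'"
    "f (- x) y = - f x y" "f x (- y) = - f x y"
    "f (x - x') y = f x y - f x' y" "f x (y - y') = f x y - f x y'"
    "f (s1 c x) y = s2 c (f x y)" "f x (s1 c y) = s2 c (f x y)"
    "f 0 y = 0" "f x 0 = 0"
    by (simp_all add: l.add l.neg l.diff l.scale l.zero r.add r.neg r.diff r.scale r.zero)
qed

lemma linear_iff_vector_space:
  "vector_space s1 \<Longrightarrow> vector_space s2 \<Longrightarrow>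
   Vector_Spaces.linear s1 s2 f \<longleftrightarrow> (\<forall>x y. f (x + y) = f x + f y) \<and> (\<forall>c x. f (s1 c x) = s2 c (f x))"
  unfolding Vector_Spaces.linear_def module_hom_def module_hom_axioms_def module_iff_vector_space
  by blast

lemma linear_simps:
  assumes "Vector_Spaces.linear s1 s2 f"
  shows "f (x + y) = f x + f y" "f (s1 c x) = s2 c (f x)" "f 0 = 0"
proof -
  interpret f: Vector_Spaces.linear s1 s2 f by fact
  show "f (x + y) = f x + f y" "f (s1 c x) = s2 c (f x)" "f 0 = 0"
    by (rule f.add f.scale f.zero)+
qed

lemma bilinear_mapI:
  assumes "vector_space s1" "vector_space s2"
    and "\<And>x x' y. f (x + x') y = f x y + f x' y" "\<And>c x y. f (s1 c x) y = s2 c (f x y)"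
    and "\<And>x y y'. f x (y + y') = f x y + f x y'" "\<And>c x y. f x (s1 c y) = s2 c (f x y)"
  shows "bilinear_map s1 s2 f"
  using assms by (simp add: bilinear_map_def linear_iff_vector_space)

section \<open>The extension of an algebra with a closed 2-form\<close>

text \<open>
  The algebra structure of the extension and the closedness of \<open>ext_omega \<omega>\<close> involve only the
  2-form. The linear form \<open>\<alpha>\<close> enters only in the theorem.
\<close>

locale closed_form_extension =
  fixes scale :: "'k::field \<Rightarrow> 'v::ab_group_add \<Rightarrow> 'v"
    and mul :: "'v \<Rightarrow> 'v \<Rightarrow> 'v" and \<phi> :: "'v \<Rightarrow> 'v" and a :: 'v and \<omega> :: "'v \<Rightarrow> 'v \<Rightarrow> 'k"
  assumes two: "(2::'k) \<noteq> 0"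
    and JJ: "JJ_algebra scale mul"
    and admissible: "admissible_pair scale mul \<phi> a"
    and \<omega>: "bilinear_map scale (*) \<omega>"
    and skew: "\<And>x y. \<omega> x y = - \<omega> y x"
    and closed: "\<And>x y z. \<omega> (mul x y) z + \<omega> (mul z x) y + \<omega> (mul y z) x = 0"
begin

lemma mul: "bilinear_map scale scale mul"
  and mul_commute: "mul x y = mul y x"
  and jacobi: "mul x (mul y z) + mul y (mul z x) + mul z (mul x y) = 0"
  using JJ by (auto simp: JJ_algebra_def)

lemma linear_\<phi>: "Vector_Spaces.linear scale scale \<phi>"
  and anti: "\<phi> (mul x y) = - mul (\<phi> x) y - mul x (\<phi> y)"
  and \<phi>_a: "\<phi> a = 0"
  and \<phi>_\<phi>: "\<phi> (\<phi> x) = scale (- (1 / 2)) (mul a x)"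
  using admissible by (auto simp: admissible_pair_def anti_derivation_def)

sublocale \<phi>: Vector_Spaces.linear scale scale \<phi> by (fact linear_\<phi>)

lemmas bilin = bilinear_map_simps[OF mul] bilinear_map_simps[OF \<omega>]
  \<phi>.add \<phi>.neg \<phi>.diff \<phi>.scale \<phi>.zero

text \<open>
  This form of \<open>\<phi>\<^sup>2 = - 1/2 L\<^sub>a\<close> eliminates the products with \<open>a\<close>, and with them the fractions, from
  the computations below.
\<close>

lemma mul_a: "mul a x = - \<phi> (\<phi> x) - \<phi> (\<phi> x)"
proof -
  have "scale (1 / 2) (mul a x) + scale (1 / 2) (mul a x) = scale (1 / 2 + 1 / 2) (mul a x)"
    by (simp only: \<phi>.vs1.scale_left_distrib)
  also have "1 / 2 + 1 / 2 = (1::'k)"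
    using two by (simp add: field_simps)
  finally show ?thesis
    by (simp add: \<phi>_\<phi> algebra_simps)
qed

lemma omega_a_a: "\<omega> a a = 0"
proof -
  have "2 * \<omega> a a = 0"
    using skew[of a a] by simp
  then show ?thesis using two by simp
qed

lemma ext_vector_space: "vector_space (ext_scale scale)"
  by unfold_locales (auto simp: ext_scale_def algebra_simps \<phi>.vs1.scale_right_distrib \<phi>.vs1.scale_left_distrib)

lemma bilinear_map_ext_mult:
  "bilinear_map (ext_scale scale) (ext_scale scale) (ext_mult scale mul \<omega> \<phi> a)"
  by (rule bilinear_mapI[OF ext_vector_space ext_vector_space])
    (auto simp: ext_scale_def ext_mult_def omega_phi_def bilin \<phi>.vs1.scale_right_distrib
      \<phi>.vs1.scale_left_distrib algebra_simps add_divide_distrib)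

lemma ext_mult_commute: "ext_mult scale mul \<omega> \<phi> a u v = ext_mult scale mul \<omega> \<phi> a v u"
  by (cases u; cases v) (simp add: ext_mult_def omega_phi_def mul_commute algebra_simps)

text \<open>
  The \<open>'v\<close>-component of the Jacobi identity for \<open>p d + x\<close>, \<open>q d + y\<close>, \<open>r d + z\<close>. The coefficient of
  \<open>p\<close> is the anti-derivation rule for \<open>y \<cdot> z\<close>, the coefficient of \<open>p q\<close> is \<open>2 \<phi> (\<phi> z) + a \<cdot> z\<close>, and
  the coefficient of \<open>p q r\<close> is a multiple of \<open>\<phi> a\<close>.
\<close>

lemma ext_jacobi_J:
  "mul x (mul y z + scale q (\<phi> z) + scale r (\<phi> y) + scale (q * r) a) +
     scale p (\<phi> (mul y z + scale q (\<phi> z) + scale r (\<phi> y) + scale (q * r) a)) +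
   (mul y (mul z x + scale r (\<phi> x) + scale p (\<phi> z) + scale (r * p) a) +
     scale q (\<phi> (mul z x + scale r (\<phi> x) + scale p (\<phi> z) + scale (r * p) a))) +
   (mul z (mul x y + scale p (\<phi> y) + scale q (\<phi> x) + scale (p * q) a) +
     scale r (\<phi> (mul x y + scale p (\<phi> y) + scale q (\<phi> x) + scale (p * q) a))) = 0"
  using jacobi[of x y z]
  by (simp add: bilin anti \<phi>_a mul_a mul_commute[of _ a] mul_commute[of "\<phi> _"]
      \<phi>.vs1.scale_right_distrib \<phi>.vs1.scale_right_diff_distrib algebra_simps)

lemma omega_mul_right: "\<omega> x (mul y z) = \<omega> (mul x y) z + \<omega> (mul z x) y"
proof -
  have "\<omega> x (mul y z) = - \<omega> (mul y z) x"
    by (rule skew)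
  also have "\<dots> = \<omega> (mul x y) z + \<omega> (mul z x) y"
    using closed[of x y z] by (simp only: add_eq_0_iff minus_minus)
  finally show ?thesis .
qed

text \<open>
  The \<open>e\<close>-component of the Jacobi identity for three elements of \<open>'v\<close>. After expansion of
  \<open>\<phi> (y \<cdot> z)\<close>, the terms that contain \<open>\<phi> x\<close> form the closedness relation of \<open>\<omega>\<close> for
  \<open>(\<phi> x, y, z)\<close>, and likewise for \<open>\<phi> y\<close> and \<open>\<phi> z\<close>.
\<close>

lemma omega_phi_cyclic:
  "omega_phi \<omega> \<phi> x (mul y z) + omega_phi \<omega> \<phi> y (mul z x) + omega_phi \<omega> \<phi> z (mul x y) = 0"
  by (simp add: omega_phi_def omega_mul_right anti bilin mul_commute)

text \<open>
  The \<open>e\<close>-component of the Jacobi identity for \<open>d\<close>, \<open>x\<close>, \<open>y\<close>. The terms \<open>\<omega>(\<phi> x, \<phi> y)\<close> cancel by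
  skew-symmetry; the remaining ones form half the closedness relation of \<open>\<omega>\<close> for \<open>(a, x, y)\<close>,
  since \<open>\<phi>\<^sup>2 = - 1/2 L\<^sub>a\<close>. This is where the factor \<open>1/2\<close> in \<open>d \<bullet> x\<close> comes from.
\<close>

lemma omega_phi_\<phi>:
  "omega_phi \<omega> \<phi> x (\<phi> y) + omega_phi \<omega> \<phi> y (\<phi> x) + 1 / 2 * \<omega> a (mul x y) = 0"
proof -
  have "\<omega> a (mul x y) = \<omega> (mul a x) y + \<omega> (mul y a) x"
    by (rule omega_mul_right)
  also have "\<dots> = - 2 * (\<omega> (\<phi> (\<phi> x)) y + \<omega> (\<phi> (\<phi> y)) x)"
    by (simp add: mul_commute[of y a] mul_a bilin algebra_simps)
  finally have "1 / 2 * \<omega> a (mul x y) = - (\<omega> (\<phi> (\<phi> x)) y + \<omega> (\<phi> (\<phi> y)) x)"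
    using two by (simp add: field_simps)
  then show ?thesis
    using skew[of "\<phi> x" "\<phi> y"] by (simp add: omega_phi_def algebra_simps)
qed

lemma omega_phi_a: "omega_phi \<omega> \<phi> x a = - \<omega> a (\<phi> x)"
  using skew[of "\<phi> x" a] by (simp add: omega_phi_def \<phi>_a bilin)

lemma ext_jacobi:
  "ext_mult scale mul \<omega> \<phi> a u (ext_mult scale mul \<omega> \<phi> a v w) +
   ext_mult scale mul \<omega> \<phi> a v (ext_mult scale mul \<omega> \<phi> a w u) +
   ext_mult scale mul \<omega> \<phi> a w (ext_mult scale mul \<omega> \<phi> a u v) = 0"
proof -
  obtain p x p' q y q' r z r' where uvw: "u = (p, x, p')" "v = (q, y, q')" "w = (r, z, r')"
    by (cases u; cases v; cases w) blast
  have lin: "omega_phi \<omega> \<phi> x (y + y') = omega_phi \<omega> \<phi> x y + omega_phi \<omega> \<phi> x y'"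
     "omega_phi \<omega> \<phi> x (scale c y) = c * omega_phi \<omega> \<phi> x y" for x y y' c
    by (simp_all add: omega_phi_def bilin algebra_simps)
  have h: "1 / 2 * (c::'k) + 1 / 2 * c = c" for c
    using two by (simp add: field_simps)
  \<comment> \<open>\<open>E x y z p q r\<close> is the \<open>e\<close>-component of the product of \<open>p d + x\<close> with \<open>(q d + y) \<bullet> (r d + z)\<close>.\<close>
  define E where "E x y z p q r =
    omega_phi \<omega> \<phi> x (mul y z + scale q (\<phi> z) + scale r (\<phi> y) + scale (q * r) a) +
     p * (1 / 2 * \<omega> a (mul y z + scale q (\<phi> z) + scale r (\<phi> y) + scale (q * r) a))" for x y z p q r
  define C where "C x y = omega_phi \<omega> \<phi> x (\<phi> y)" for x y
  define H where "H x = 1 / 2 * \<omega> a x" for x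
  have \<omega>a: "\<omega> a (\<phi> x) = H (\<phi> x) + H (\<phi> x)" for x
    unfolding H_def by (rule h[symmetric])
  have Hm: "H (mul x y) = - C x y - C y x" for x y
    using omega_phi_\<phi>[of x y] unfolding C_def H_def by (simp add: algebra_simps eq_neg_iff_add_eq_0)
  have Ha: "H a = 0"
    by (simp add: H_def omega_a_a)
  have Hlin: "H (x + y) = H x + H y" "H (scale c x) = c * H x" for x y c
    by (simp_all add: H_def bilin algebra_simps)
  \<comment> \<open>All products with \<open>d\<close> are expressed by \<open>C\<close> and \<open>H\<close>, whose contributions then cancel in the cyclic sum.\<close>
  have E: "E x y z p q r = omega_phi \<omega> \<phi> x (mul y z) + q * C x z + r * C x y
      - q * r * (H (\<phi> x) + H (\<phi> x)) + p * (- C y z - C z y + q * H (\<phi> z) + r * H (\<phi> y))" for x y z p q r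
    unfolding E_def lin omega_phi_a H_def[symmetric] \<omega>a C_def[symmetric] Hlin Ha Hm by simp
  have "E x y z p q r + E y z x q r p + E z x y r p q = 
     omega_phi \<omega> \<phi> x (mul y z) + omega_phi \<omega> \<phi> y (mul z x) + omega_phi \<omega> \<phi> z (mul x y)"
    unfolding E by (simp add: algebra_simps)
  then have "E x y z p q r + E y z x q r p + E z x y r p q = 0"
    by (simp only: omega_phi_cyclic)
  then show ?thesis
    using ext_jacobi_J[of x y z q r p] by (simp add: uvw ext_mult_def zero_prod_def E_def bilin)
qed

lemma bilinear_map_ext_omega: "bilinear_map (ext_scale scale) (*) (ext_omega \<omega>)"
  by (rule bilinear_mapI[OF ext_vector_space])
    (auto simp: ext_scale_def ext_omega_def ext_proj_def wedge_lin_def d_star_def e_star_def bilin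
      algebra_simps intro: finite_dimensional_vector_space.axioms(1)[OF finite_dimensional_over_itself])

lemma ext_omega_skew: "ext_omega \<omega> u v = - ext_omega \<omega> v u"
  using skew[of "ext_proj u" "ext_proj v"] by (simp add: ext_omega_def wedge_lin_def)

lemma ext_omega_closed:
  "ext_omega \<omega> (ext_mult scale mul \<omega> \<phi> a u v) w + ext_omega \<omega> (ext_mult scale mul \<omega> \<phi> a w u) v
    + ext_omega \<omega> (ext_mult scale mul \<omega> \<phi> a v w) u = 0"
proof -
  obtain p x p' q y q' r z r' where uvw: "u = (p, x, p')" "v = (q, y, q')" "w = (r, z, r')"
    by (cases u; cases v; cases w) blast
  define H where "H x = 1 / 2 * \<omega> a x" for x
  have \<omega>a: "\<omega> a x = H x + H x" for x
    using two by (simp add: H_def field_simps)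
  have c: "\<omega> (mul x y) z = - \<omega> (mul z x) y - \<omega> (mul y z) x"
    using closed[of x y z] by (simp add: algebra_simps eq_neg_iff_add_eq_0)
  show ?thesis
    unfolding uvw ext_omega_def ext_mult_def ext_proj_def wedge_lin_def d_star_def e_star_def
      omega_phi_def prod.case fst_conv snd_conv bilin H_def[symmetric] \<omega>a
    by (simp add: c algebra_simps)
qed

lemma ext_JJ_algebra: "JJ_algebra (ext_scale scale) (ext_mult scale mul \<omega> \<phi> a)"
proof -
  obtain B where "finite_dimensional_vector_space scale B"
    using JJ by (auto simp: JJ_algebra_def)
  then have "\<exists>B'. finite_dimensional_vector_space (ext_scale scale) B'"
    by (rule ext_finite_dimensional(1))
  then show ?thesis
    unfolding JJ_algebra_def
    using bilinear_map_ext_mult ext_mult_commute ext_jacobi by blast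
qed

end

section \<open>The cosymplectic structure\<close>

theorem theorem4p1:
  fixes scale :: "'k::field \<Rightarrow> 'v::ab_group_add \<Rightarrow> 'v"
    and mul :: "'v \<Rightarrow> 'v \<Rightarrow> 'v"
    and \<alpha> :: "'v \<Rightarrow> 'k" and \<omega> :: "'v \<Rightarrow> 'v \<Rightarrow> 'k"
    and \<phi> :: "'v \<Rightarrow> 'v" and a :: 'v and t :: 'k and n :: nat
  assumes char_ne_2_3: "CHAR('k) \<noteq> 2" "CHAR('k) \<noteq> 3"
    and cosymplectic: "cosymplectic n scale mul \<alpha> \<omega>"
    and admissible: "admissible_pair scale mul \<phi> a"
    and alpha_phi: "\<alpha> \<circ> \<phi> = (\<lambda>_. 0)"
    and omega_phi_a: "\<forall>x. \<omega> (\<phi> x) a = 0"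
    and alpha_a: "\<alpha> a = 0"
    and char_ndvd: "\<not> CHAR('k) dvd n + 1"
  shows "cosymplectic (n + 1) (ext_scale scale) (ext_mult scale mul \<omega> \<phi> a)
           (ext_alpha \<alpha> t) (ext_omega \<omega>)"
proof -
  have "(2::'k) \<noteq> 0"
  proof
    assume "(2::'k) = 0"
    then have dvd: "CHAR('k) dvd 2"
      using of_nat_eq_0_iff_char_dvd[of 2, where 'a = 'k] by (simp only: of_nat_numeral simp_thms)
    then obtain m where m: "2 = CHAR('k) * m" ..
    have "CHAR('k) \<noteq> 1"
      unfolding One_nat_def by (rule CHAR_not_1')
    moreover have "CHAR('k) \<noteq> 0"
      using m by (intro notI) (simp only: mult_0 zero_neq_numeral)
    moreover have "CHAR('k) \<le> 2"
      using dvd by (rule dvd_imp_le) (rule zero_less_numeral)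
    ultimately show False
      using char_ne_2_3(1) by linarith
  qed
  then interpret closed_form_extension scale mul \<phi> a \<omega>
    using cosymplectic admissible unfolding closed_form_extension_def cosymplectic_def by blast

  have dim_v: "vector_space.dim scale UNIV = 2 * n + 1"
    and \<alpha>: "Vector_Spaces.linear scale (*) \<alpha>" and \<alpha>_mul: "\<alpha> (mul x y) = 0"
    and top_form: "wedge 1 (2 * n) (form1 \<alpha>) (wedge_power \<omega> n) \<noteq> (\<lambda>_. 0)" for x y
    using cosymplectic unfolding cosymplectic_def by blast+

  obtain B where "finite_dimensional_vector_space scale B"
    using JJ by (auto simp: JJ_algebra_def)
  then have dim: "vector_space.dim (ext_scale scale) UNIV = 2 * (n + 1) + 1"
    using dim_v by (simp add: ext_finite_dimensional(2))

  have \<alpha>_lin: "\<alpha> (x + y) = \<alpha> x + \<alpha> y" "\<alpha> (scale c x) = c * \<alpha> x" "\<alpha> 0 = 0" for x y c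
    by (rule linear_simps[OF \<alpha>])+
  have lin: "Vector_Spaces.linear (ext_scale scale) (*) (ext_alpha \<alpha> t)"
    using finite_dimensional_vector_space.axioms(1)[OF finite_dimensional_over_itself]
    by (rule linear_iff_vector_space[OF ext_vector_space, THEN iffD2])
      (simp add: ext_alpha_def ext_proj_def d_star_def ext_scale_def split_beta \<alpha>_lin algebra_simps)
  have "\<alpha> (\<phi> x) = 0" for x
    using alpha_phi by (simp add: fun_eq_iff)
  then have kills: "ext_alpha \<alpha> t (ext_mult scale mul \<omega> \<phi> a u v) = 0" for u v
    by (cases u; cases v) (simp add: ext_alpha_def ext_mult_def ext_proj_def d_star_def
        \<alpha>_lin \<alpha>_mul alpha_a)

  \<comment> \<open>If \<open>\<alpha> \<and> \<omega>\<^sup>n\<close> is non-zero at \<open>v\<close>, then the extended top form is non-zero at \<open>(d, e, v)\<close>.\<close>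
  obtain v where v: "wedge 1 (2 * n) (form1 \<alpha>) (wedge_power \<omega> n) v \<noteq> 0"
    using top_form by blast
  have "wedge 1 (2 * Suc n) (form1 (ext_alpha \<alpha> t)) (wedge_power (ext_omega \<omega>) (Suc n))
      (case_nat ext_d (case_nat ext_e (\<lambda>i. ext_in (v i)))) =
    of_nat (Suc n) * wedge 1 (2 * n) (form1 \<alpha>) (wedge_power \<omega> n) v"
    by (rule wedge_form1_hyperbolic_pair)
      (simp_all add: ext_omega_def ext_alpha_def ext_proj_def wedge_lin_def d_star_def e_star_def
        ext_d_def ext_e_def ext_in_def bilin \<alpha>_lin)
  moreover have "of_nat (Suc n) \<noteq> (0::'k)"
    using char_ndvd by (simp only: of_nat_eq_0_iff_char_dvd Suc_eq_plus1 simp_thms)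
  ultimately have "wedge 1 (2 * (n + 1)) (form1 (ext_alpha \<alpha> t))
      (wedge_power (ext_omega \<omega>) (n + 1)) \<noteq> (\<lambda>_. 0)"
    using v by (metis Suc_eq_plus1 mult_eq_0_iff)
  then show ?thesis
    unfolding cosymplectic_def
    using ext_JJ_algebra dim lin bilinear_map_ext_omega ext_omega_skew kills ext_omega_closed
    by blast
qed

end
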